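(* There is an absolute constant $C>0$ such that for all locally integrable functions $b,d$ on $\mathbb{R}$ with $b,d\in BMO^{\mathcal{D}}$, $$\|\widehat{S}(b\circ d)\|_{CM}+\|E(b\circ d)\|_{\ell^\infty}\le C\,\|b\|_{BMO^{\mathcal{D}}}\|d\|_{BMO^{\mathcal{D}}},$$ where $b\circ d=\{\langle b,h_I\rangle\langle d,h_I\rangle\}_{I\in\mathcal{D}}$.
   Context: $\mathcal{D}$ is the standard dyadic grid of intervals on $\mathbb{R}$. For $I\in\mathcal{D}$, $I^+$ and $I^-$ are the left and right dyadic children of $I$, and $h_I=|I|^{-1/2}(\mathbf{1}_{I^+}-\mathbf{1}_{I^-})$ is the Haar function; $\langle b,h_I\rangle=\int b\,h_I\,dx$. For $J\subsetneq I$ in $\mathcal{D}$, $h_I(J)$ denotes the constant value of $h_I$ on $J$. The relation $J\subset I$ allows $J=I$. The dyadic BMO norm is $\|b\|_{BMO^{\mathcal{D}}}=\sup_{I\in\mathcal{D}}\frac1{|I|}\int_I|b-\langle b\rangle_I|\,dx$ with $\langle b\rangle_I=\frac1{|I|}\int_Ib\,dx$, and $b\in BMO^{\mathcal{D}}$ means this is finite. For a complex sequence $a=\{a_I\}_{I\in\mathcal{D}}$, $$\widehat{S}(a)=\Big\{\sum_{J\subsetneq I}a_Jh_I(J)\Big\}_{I\in\mathcal{D}},\qquad E(a)=\Big\{\frac1{|I|}\sum_{J\subset I}a_J\Big\}_{I\in\mathcal{D}},$$ where the sums are over $J\in\mathcal{D}$. Also $$\|a\|_{CM}=\Big(\sup_{I\in\mathcal{D}}\frac1{|I|}\sum_{J\subset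 I}|a_J|^2\Big)^{1/2},\qquad \|a\|_{\ell^\infty}=\sup_{I\in\mathcal{D}}|a_I|.$$ *)

theory Defs
  imports "HOL-Analysis.Analysis"
begin

definition dyadic_grid :: "real set set" where
  "dyadic_grid = {{of_int k * 2 powi n ..< of_int (k + 1) * 2 powi n} | k n :: int. True}"

definition left_child :: "real set \<Rightarrow> real set" where
  "left_child I = {Inf I ..< (Inf I + Sup I) / 2}"

definition right_child :: "real set \<Rightarrow> real set" where
  "right_child I = {(Inf I + Sup I) / 2 ..< Sup I}"

text \<open>Sign convention: the Haar function is positive on the left child.\<close>

definition haar :: "real set \<Rightarrow> real \<Rightarrow> real" where
  "haar I x = (indicator (left_child I) x - indicator (right_child I) x) / sqrt (measure lebesgue I)"

definition haar_val :: "real set \<Rightarrow> real set \<Rightarrow> real" where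
  "haar_val I J = (THE c. \<forall>x\<in>J. haar I x = c)"

definition locally_integrable :: "(real \<Rightarrow> complex) \<Rightarrow> bool" where
  "locally_integrable b \<longleftrightarrow> (\<forall>K. compact K \<longrightarrow> set_integrable lebesgue K b)"

definition haar_coeff :: "(real \<Rightarrow> complex) \<Rightarrow> real set \<Rightarrow> complex" where
  "haar_coeff b I = (LINT x|lebesgue. b x * of_real (haar I x))"

definition average :: "(real \<Rightarrow> complex) \<Rightarrow> real set \<Rightarrow> complex" where
  "average b I = (LINT x:I|lebesgue. b x) / of_real (measure lebesgue I)"

text \<open>
  Norms take values in \<^typ>\<open>ennreal\<close>, so that the suprema always exist and an infinite norm
  is represented as such.
\<close>

definition bmo_norm :: "(real \<Rightarrow> complex) \<Rightarrow> ennreal" where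
  "bmo_norm b = (SUP I\<in>dyadic_grid.
     ennreal (1 / measure lebesgue I) *
     (\<integral>\<^sup>+x\<in>I. ennreal (cmod (b x - average b I)) \<partial>lebesgue))"

definition in_bmo :: "(real \<Rightarrow> complex) \<Rightarrow> bool" where
  "in_bmo b \<longleftrightarrow> bmo_norm b < \<infinity>"

text \<open>
  Sequences indexed by the dyadic grid are functions on \<^typ>\<open>real set\<close> of which only the values on
  \<^const>\<open>dyadic_grid\<close> matter. The sums below are unordered; as \<open>infsum\<close> is \<open>0\<close> for a
  non-summable family, \<open>S_hat\<close> and \<open>E_op\<close> are to be read together with the summability
  predicates \<open>S_hat_summable\<close> and \<open>E_op_summable\<close>.
\<close>

definition haar_product :: "(real \<Rightarrow> complex) \<Rightarrow> (real \<Rightarrow> complex) \<Rightarrow> real set \<Rightarrow> complex" where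
  "haar_product b d I = haar_coeff b I * haar_coeff d I"

definition S_hat :: "(real set \<Rightarrow> complex) \<Rightarrow> real set \<Rightarrow> complex" where
  "S_hat a I = (\<Sum>\<^sub>\<infinity>J\<in>{J\<in>dyadic_grid. J \<subset> I}. a J * of_real (haar_val I J))"

definition S_hat_summable :: "(real set \<Rightarrow> complex) \<Rightarrow> bool" where
  "S_hat_summable a \<longleftrightarrow>
     (\<forall>I\<in>dyadic_grid. (\<lambda>J. a J * of_real (haar_val I J)) summable_on {J\<in>dyadic_grid. J \<subset> I})"

definition E_op :: "(real set \<Rightarrow> complex) \<Rightarrow> real set \<Rightarrow> complex" where
  "E_op a I = (\<Sum>\<^sub>\<infinity>J\<in>{J\<in>dyadic_grid. J \<subseteq> I}. a J) / of_real (measure lebesgue I)"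

definition E_op_summable :: "(real set \<Rightarrow> complex) \<Rightarrow> bool" where
  "E_op_summable a \<longleftrightarrow> (\<forall>I\<in>dyadic_grid. a summable_on {J\<in>dyadic_grid. J \<subseteq> I})"

definition ennreal_sqrt :: "ennreal \<Rightarrow> ennreal" where
  "ennreal_sqrt x = (if x = \<infinity> then \<infinity> else ennreal (sqrt (enn2real x)))"

definition cm_norm :: "(real set \<Rightarrow> complex) \<Rightarrow> ennreal" where
  "cm_norm a = ennreal_sqrt (SUP I\<in>dyadic_grid.
     ennreal (1 / measure lebesgue I) *
     (\<Sum>\<^sub>\<infinity>J\<in>{J\<in>dyadic_grid. J \<subseteq> I}. ennreal ((cmod (a J))\<^sup>2)))"

definition linf_norm :: "(real set \<Rightarrow> complex) \<Rightarrow> ennreal" where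
  "linf_norm a = (SUP I\<in>dyadic_grid. ennreal (cmod (a I)))"

end

(* Write m_I for the average of b over I and c for its dyadic BMO norm.  The identity
   |<b,h_I>|^2 + |I| |m_I - z|^2 = |I^+| |m_{I^+} - z|^2 + |I^-| |m_{I^-} - z|^2
   lets one sum Haar coefficients down the tree until |m_J - z| reaches 2c.  The intervals J where
   this happens have total length at most (1/2c) times the integral of |b - z|, so with z = m_I they
   cover at most half of I; induction on the depth then gives the Carleson bound
   sum_{J <= I} |<b,h_J>|^2 <= 18 c^2 |I|.

   By Cauchy-Schwarz, a = b o d satisfies sum_{J <= I} |a_J| <= K |I|, which is the bound on E.
   With P_I = sum_{J <= I} a_J one has S_I = (P_{I^+} - P_{I^-}) / sqrt |I| and P_I = a_I + P_{I^+} + P_{I^-},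
   so |S_I|^2 is at most the increment of the potential |P_I|^2 / |I| plus 2 K |a_I|; telescoping
   gives the Carleson bound for S. *)

theory Submission
  imports Defs
begin

section \<open>Dyadic intervals: children and nestedness\<close>

lemma dyadic_gridE:
  assumes "I \<in> dyadic_grid"
  obtains k n :: int where "I = {of_int k * 2 powi n ..< of_int (k + 1) * 2 powi n}"
  using assms by (auto simp: dyadic_grid_def)

text \<open>The children are put back into grid form, with indices 2k and 2k+1 at scale n-1. The
  unsimplified \<open>2*k + 1 + 1\<close> keeps the right child literally an instance of the pattern
  in \<open>dyadic_grid\<close>.\<close>

lemma dyadic_interval:
  fixes k n :: int
  defines "I \<equiv> {of_int k * 2 powi n ..< of_int (k + 1) * (2::real) powi n}"
  shows "Inf I = of_int k * 2 powi n" "Sup I = of_int (k + 1) * 2 powi n"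
    "measure lebesgue I = 2 powi n"
    "left_child I = {of_int (2*k) * 2 powi (n-1) ..< of_int (2*k + 1) * 2 powi (n-1)}"
    "right_child I = {of_int (2*k+1) * 2 powi (n-1) ..< of_int (2*k + 1 + 1) * 2 powi (n-1)}"
proof -
  have pos: "(2::real) powi n > 0" by simp
  have lt: "of_int k * 2 powi n < of_int (k + 1) * (2::real) powi n"
    using pos by (simp add: algebra_simps)
  show 1: "Inf I = of_int k * 2 powi n" and 2: "Sup I = of_int (k + 1) * 2 powi n"
    unfolding I_def using lt by (auto intro: cInf_atLeastLessThan cSup_atLeastLessThan)
  show "measure lebesgue I = 2 powi n"
    unfolding I_def using lt by (simp add: algebra_simps)
  have half: "(2::real) powi n = 2 * 2 powi (n-1)"
    using power_int_add[of "2::real" 1 "n-1"] by simp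
  show "left_child I = {of_int (2*k) * 2 powi (n-1) ..< of_int (2*k + 1) * 2 powi (n-1)}"
    "right_child I = {of_int (2*k+1) * 2 powi (n-1) ..< of_int (2*k + 1 + 1) * 2 powi (n-1)}"
    unfolding left_child_def right_child_def 1 2 half by (auto simp: algebra_simps)
qed

lemma dyadic_children:
  assumes "I \<in> dyadic_grid"
  shows "left_child I \<in> dyadic_grid" "right_child I \<in> dyadic_grid"
    "I = left_child I \<union> right_child I" "left_child I \<inter> right_child I = {}"
    "measure lebesgue (left_child I) = measure lebesgue I / 2"
    "measure lebesgue (right_child I) = measure lebesgue I / 2"
    "measure lebesgue I > 0" "I \<noteq> {}" "I \<in> sets lebesgue"
    "emeasure lebesgue I = ennreal (measure lebesgue I)"
proof -
  obtain k n :: int where I: "I = {of_int k * 2 powi n ..< of_int (k + 1) * 2 powi n}"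
    using assms by (rule dyadic_gridE)
  note ch = dyadic_interval[of k n, folded I] dyadic_interval(3)[of "2*k" "n-1"]
    dyadic_interval(3)[of "2*k+1" "n-1"]
  have half: "(2::real) powi n = 2 * 2 powi (n-1)"
    using power_int_add[of "2::real" 1 "n-1"] by simp
  have pos: "(2::real) powi (n-1) > 0" by simp
  show "left_child I \<in> dyadic_grid" "right_child I \<in> dyadic_grid"
    unfolding ch dyadic_grid_def by blast+
  show "I = left_child I \<union> right_child I" "left_child I \<inter> right_child I = {}"
    unfolding ch unfolding I half using pos by (auto simp: algebra_simps)
  show "measure lebesgue (left_child I) = measure lebesgue I / 2"
    "measure lebesgue (right_child I) = measure lebesgue I / 2"
    "measure lebesgue I > 0"
    unfolding ch half using pos by auto
  show "I \<noteq> {}" unfolding I using pos half by auto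
  show "I \<in> sets lebesgue" unfolding I by simp
  show "emeasure lebesgue I = ennreal (measure lebesgue I)"
    unfolding I by (intro emeasure_eq_measure2 bounded_set_imp_lmeasurable) auto
qed

text \<open>Containment forces the scale of \<open>J\<close> to be at most that of \<open>I\<close>.
  If it is strictly smaller, the midpoint of \<open>I\<close> is a grid point at the scale of
  \<open>J\<close>, so it cannot be interior to \<open>J\<close>.\<close>

lemma dyadic_nested:
  assumes J: "J \<in> dyadic_grid" and I: "I \<in> dyadic_grid" and "J \<subseteq> I"
  shows "J = I \<or> J \<subseteq> left_child I \<or> J \<subseteq> right_child I"
proof -
  obtain k n :: int where J': "J = {of_int k * 2 powi n ..< of_int (k + 1) * 2 powi n}"
    using J by (rule dyadic_gridE)
  obtain l m :: int where I': "I = {of_int l * 2 powi m ..< of_int (l + 1) * 2 powi m}"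
    using I by (rule dyadic_gridE)
  have pos: "(2::real) powi n > 0" by simp
  have "of_int k * 2 powi n < of_int (k + 1) * (2::real) powi n"
    using pos by (simp add: algebra_simps)
  then have le: "of_int l * 2 powi m \<le> of_int k * (2::real) powi n"
      "of_int (k+1) * (2::real) powi n \<le> of_int (l+1) * 2 powi m"
    using \<open>J \<subseteq> I\<close> unfolding I' J' by (auto simp: ivl_subset)
  have "(2::real) powi n \<le> 2 powi m" using le by (simp add: algebra_simps)
  then have "n \<le> m" using power_int_strict_increasing[of m n "2::real"] by (cases "n \<le> m") auto
  show ?thesis
  proof (cases "n = m")
    case True
    then have "l = k" using le pos by simp
    then show ?thesis using True I' J' by simp
  next
    case False
    define p where "p = nat (m - 1 - n)"
    have m: "m - 1 = int p + n" using False \<open>n \<le> m\<close> by (simp add: p_def)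
    have pw: "(2::real) powi (m-1) = of_int (2 ^ p) * 2 powi n"
      unfolding m by (simp add: power_int_add)
    \<comment> \<open>Index of the midpoint of \<open>I\<close> on the grid of mesh 2^n; it is an
      integer because n <= m - 1.\<close>
    define q where "q = (2*l+1) * 2^p"
    have mid: "of_int (2*l+1) * (2::real) powi (m-1) = of_int q * 2 powi n"
      unfolding pw q_def by simp
    have half: "(2::real) powi m = 2 * 2 powi (m-1)"
      using power_int_add[of "2::real" 1 "m-1"] by simp
    have ends: "of_int (2*l) * (2::real) powi (m-1) = of_int l * 2 powi m"
      "of_int (2*l+1+1) * (2::real) powi (m-1) = of_int (l+1) * 2 powi m"
      unfolding half by (simp_all add: algebra_simps)
    consider "k + 1 \<le> q" | "q \<le> k" by linarith
    then show ?thesis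
    proof cases
      case 1
      then have "of_int (k+1) * (2::real) powi n \<le> of_int q * 2 powi n"
        using pos by (intro mult_right_mono) (auto simp del: of_int_add)
      then have "J \<subseteq> left_child I"
        unfolding I' dyadic_interval mid ends unfolding J' using le by auto
      then show ?thesis by blast
    next
      case 2
      then have "of_int q * (2::real) powi n \<le> of_int k * 2 powi n"
        using pos by (intro mult_right_mono) auto
      then have "J \<subseteq> right_child I"
        unfolding I' dyadic_interval mid ends unfolding J' using le by auto
      then show ?thesis by blast
    qed
  qed
qed

section \<open>The tree of dyadic subintervals and its finite truncations\<close>

abbreviation dyadic_below :: "real set \<Rightarrow> real set set" where
  "dyadic_below I \<equiv> {J \<in> dyadic_grid. J \<subseteq> I}"

text \<open>Nonemptiness does the work twice: for the children it makes them proper subsets of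
  \<open>I\<close>, and for an arbitrary dyadic interval it prevents membership in both
  subtrees.\<close>

lemma dyadic_below_strict:
  assumes "I \<in> dyadic_grid"
  shows "{J \<in> dyadic_grid. J \<subset> I} = dyadic_below (left_child I) \<union> dyadic_below (right_child I)"
    "dyadic_below (left_child I) \<inter> dyadic_below (right_child I) = {}"
    "dyadic_below I = insert I (dyadic_below (left_child I) \<union> dyadic_below (right_child I))"
    "I \<notin> dyadic_below (left_child I) \<union> dyadic_below (right_child I)"
proof -
  note c = dyadic_children[OF assms]
  have ne: "left_child I \<noteq> {}" "right_child I \<noteq> {}"
    using dyadic_children(8) c(1,2) by blast+
  have sub: "left_child I \<subset> I" "right_child I \<subset> I"
    using c(3,4) ne by blast+
  show "{J \<in> dyadic_grid. J \<subset> I} = dyadic_below (left_child I) \<union> dyadic_below (right_child I)"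
    using dyadic_nested[OF _ assms] sub by blast
  show "dyadic_below (left_child I) \<inter> dyadic_below (right_child I) = {}"
    using c(4) dyadic_children(8) by blast
  show "dyadic_below I = insert I (dyadic_below (left_child I) \<union> dyadic_below (right_child I))"
    using dyadic_nested[OF _ assms] sub assms by blast
  show "I \<notin> dyadic_below (left_child I) \<union> dyadic_below (right_child I)"
    using sub by blast
qed

text \<open>Truncation to the first n generations, \<open>I\<close> itself being the first. Sums
  over it are finite, so estimates go by induction on the depth and then pass to infinite
  sums.\<close>

primrec descendants :: "nat \<Rightarrow> real set \<Rightarrow> real set set" where
  "descendants 0 I = {}"
| "descendants (Suc n) I =
     insert I (descendants n (left_child I) \<union> descendants n (right_child I))"

lemma finite_descendants: "finite (descendants n I)"
  by (induction n arbitrary: I) auto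

lemma descendants_subset:
  assumes "I \<in> dyadic_grid"
  shows "descendants n I \<subseteq> dyadic_below I"
  using assms
proof (induction n arbitrary: I)
  case (Suc n)
  show ?case
    using Suc.IH[of "left_child I"] Suc.IH[of "right_child I"] dyadic_children(1,2)[OF Suc.prems]
      dyadic_below_strict(3)[OF Suc.prems] by auto
qed simp

lemma sum_descendants_Suc:
  fixes f :: "real set \<Rightarrow> 'a::comm_monoid_add"
  assumes "I \<in> dyadic_grid"
  shows "sum f (descendants (Suc n) I) =
    f I + (sum f (descendants n (left_child I)) + sum f (descendants n (right_child I)))"
proof -
  note s = descendants_subset[OF dyadic_children(1)[OF assms], of n]
    descendants_subset[OF dyadic_children(2)[OF assms], of n]
  have "I \<notin> descendants n (left_child I) \<union> descendants n (right_child I)"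
    using dyadic_below_strict(4)[OF assms] Un_mono[OF s] by (rule contra_subsetD[rotated])
  moreover have "descendants n (left_child I) \<inter> descendants n (right_child I) = {}"
    using Int_mono[OF s] unfolding dyadic_below_strict(2)[OF assms] by simp
  ultimately show ?thesis
    by (simp add: sum.union_disjoint finite_descendants)
qed

lemma descendants_mono: "m \<le> n \<Longrightarrow> descendants m I \<subseteq> descendants n I"
proof (induction n arbitrary: m I)
  case (Suc n)
  show ?case
  proof (cases m)
    case (Suc k)
    then show ?thesis using Suc.IH[of k "left_child I"] Suc.IH[of k "right_child I"] Suc.prems by auto
  qed simp
qed simp

text \<open>Each generation halves the length, so \<open>J\<close> at generation p satisfies |I| =
  2^p |J| and is reached exactly when p < n; hence the strict inequality.\<close>

lemma mem_descendants:
  assumes "J \<in> dyadic_grid" "I \<in> dyadic_grid" "J \<subseteq> I"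
    "measure lebesgue I < 2 ^ n * measure lebesgue J"
  shows "J \<in> descendants n I"
  using assms
proof (induction n arbitrary: I)
  case 0
  have "measure lebesgue J \<le> measure lebesgue I"
    using 0 dyadic_children(10)
    by (metis dyadic_children(7,9) emeasure_mono ennreal_le_iff less_imp_le)
  then show ?case using 0 by simp
next
  case (Suc n)
  note c = dyadic_children[OF Suc.prems(2)]
  show ?case
    using dyadic_nested[OF Suc.prems(1-3)] Suc.IH[of "left_child I"] Suc.IH[of "right_child I"]
      Suc.prems c by auto
qed

lemma finite_dyadic_below_descendants:
  assumes "I \<in> dyadic_grid" "finite F" "F \<subseteq> dyadic_below I"
  shows "\<exists>n. F \<subseteq> descendants n I"
  using assms(2,3)
proof (induction F)
  case (insert J F)
  then obtain n where n: "F \<subseteq> descendants n I" by auto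
  have "measure lebesgue J > 0" using insert dyadic_children(7) by auto
  then obtain m :: nat where "measure lebesgue I / measure lebesgue J < 2 ^ m"
    using real_arch_pow[of 2] by auto
  then have "J \<in> descendants m I"
    using insert assms \<open>measure lebesgue J > 0\<close>
    by (intro mem_descendants) (auto simp: field_simps)
  then show ?case
    using n descendants_mono[of n "max m n" I] descendants_mono[of m "max m n" I]
    by (intro exI[of _ "max m n"]) auto
qed simp

text \<open>Unordered sums are controlled through arbitrary finite index sets. Each such set lies in
  a deep enough truncation, so bounds uniform in the depth suffice.\<close>

lemma finite_sum_dyadic_below_le:
  fixes f :: "real set \<Rightarrow> real"
  assumes "I \<in> dyadic_grid" "\<And>J. f J \<ge> 0" "\<And>n. sum f (descendants n I) \<le> B"
    "finite F" "F \<subseteq> dyadic_below I"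
  shows "sum f F \<le> B"
proof -
  obtain n where "F \<subseteq> descendants n I"
    using finite_dyadic_below_descendants[OF assms(1,4,5)] by blast
  then have "sum f F \<le> sum f (descendants n I)"
    by (intro sum_mono2) (auto simp: finite_descendants assms)
  with assms(3)[of n] show ?thesis by linarith
qed

lemma summable_on_dyadic_below:
  fixes a :: "real set \<Rightarrow> complex"
  assumes "I \<in> dyadic_grid" "\<And>n. (\<Sum>J\<in>descendants n I. cmod (a J)) \<le> B"
  shows "a summable_on dyadic_below I" "cmod (infsum a (dyadic_below I)) \<le> B"
proof -
  have fin: "(\<Sum>J\<in>F. cmod (a J)) \<le> B" if "finite F" "F \<subseteq> dyadic_below I" for F
    using finite_sum_dyadic_below_le[OF assms(1) _ assms(2) that] by simp
  have sm: "(\<lambda>J. cmod (a J)) summable_on dyadic_below I"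
    by (rule nonneg_bounded_partial_sums_imp_summable_on[of _ _ B])
       (auto simp: eventually_finite_subsets_at_top intro!: exI[of _ "{}"] fin)
  then show "a summable_on dyadic_below I" by (rule abs_summable_summable)
  have "cmod (infsum a (dyadic_below I)) \<le> (\<Sum>\<^sub>\<infinity>J\<in>dyadic_below I. cmod (a J))"
    using sm by (rule norm_infsum_bound)
  also have "\<dots> \<le> B"
    using sm fin by (intro infsum_le_finite_sums) auto
  finally show "cmod (infsum a (dyadic_below I)) \<le> B" .
qed

section \<open>Averages over dyadic intervals and Haar coefficients\<close>

lemma parallelogram_shift:
  fixes u v z :: complex
  shows "(cmod (u - z))\<^sup>2 + (cmod (v - z))\<^sup>2 = 2 * (cmod ((u + v) / 2 - z))\<^sup>2 + (cmod (u - v))\<^sup>2 / 2"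
  unfolding cmod_power2 by (simp add: power2_eq_square field_simps)

lemma set_integrable_dyadic:
  assumes "locally_integrable b" "I \<in> dyadic_grid"
  shows "set_integrable lebesgue I b"
proof -
  obtain k n :: int where I: "I = {of_int k * 2 powi n ..< of_int (k + 1) * 2 powi n}"
    using assms(2) by (rule dyadic_gridE)
  have "set_integrable lebesgue {of_int k * 2 powi n .. of_int (k + 1) * 2 powi n} b"
    using assms(1) by (simp add: locally_integrable_def)
  then show ?thesis
    by (rule set_integrable_subset) (auto simp: I)
qed

lemma set_integrable_cmod_diff:
  assumes "locally_integrable b" "I \<in> dyadic_grid"
  shows "set_integrable lebesgue I (\<lambda>x. b x - z)" "set_integrable lebesgue I (\<lambda>x. cmod (b x - z))"
proof -
  have "set_integrable lebesgue I (\<lambda>x. z)"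
    unfolding set_integrable_def using dyadic_children(9,10)[OF assms(2)] by simp
  then show 1: "set_integrable lebesgue I (\<lambda>x. b x - z)"
    using set_integrable_dyadic[OF assms] by simp
  show "set_integrable lebesgue I (\<lambda>x. cmod (b x - z))"
    using 1 by (rule set_integrable_norm)
qed

lemma set_integral_dyadic_split:
  fixes f :: "real \<Rightarrow> 'a::{banach, second_countable_topology}"
  assumes "I \<in> dyadic_grid" "set_integrable lebesgue I f"
  shows "(LINT x:I|lebesgue. f x) =
    (LINT x:left_child I|lebesgue. f x) + (LINT x:right_child I|lebesgue. f x)"
proof -
  note c = dyadic_children[OF assms(1)]
  have "set_integrable lebesgue (left_child I) f" "set_integrable lebesgue (right_child I) f"
    using assms(2) by (rule set_integrable_subset; use c dyadic_children(9) in blast)+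
  from set_integral_Un[OF c(4) this] show ?thesis
    using c(3) by simp
qed

lemma integral_eq_average:
  assumes "I \<in> dyadic_grid"
  shows "(LINT x:I|lebesgue. b x) = of_real (measure lebesgue I) * average b I"
  using dyadic_children(7)[OF assms] by (simp add: average_def)

lemma average_children:
  assumes "locally_integrable b" "I \<in> dyadic_grid"
  shows "average b I = (average b (left_child I) + average b (right_child I)) / 2"
  using set_integral_dyadic_split[OF assms(2) set_integrable_dyadic[OF assms]]
    dyadic_children(7)[OF assms(2)]
  by (simp add: average_def dyadic_children(5,6)[OF assms(2)] add_divide_distrib)

text \<open>The integral over a child is |I|/2 times the average there, so the coefficient is sqrt
  |I| / 2 times the difference of the two averages.\<close>

lemma cmod_haar_coeff_square:
  assumes "locally_integrable b" "I \<in> dyadic_grid"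
  shows "(cmod (haar_coeff b I))\<^sup>2 =
    measure lebesgue I * (cmod (average b (left_child I) - average b (right_child I)))\<^sup>2 / 4"
proof -
  note c = dyadic_children[OF assms(2)]
  let ?m = "measure lebesgue I"
  have int: "integrable lebesgue (\<lambda>x. indicator J x *\<^sub>R b x)" if "J \<in> dyadic_grid" for J
    using set_integrable_dyadic[OF assms(1) that] by (simp add: set_integrable_def)
  have "haar_coeff b I = (LINT x|lebesgue.
      (indicator (left_child I) x *\<^sub>R b x - indicator (right_child I) x *\<^sub>R b x) / of_real (sqrt ?m))"
    unfolding haar_coeff_def haar_def
    by (intro Bochner_Integration.integral_cong) (auto simp: indicator_def)
  also have "\<dots> = ((LINT x:left_child I|lebesgue. b x) - (LINT x:right_child I|lebesgue. b x))
      / of_real (sqrt ?m)"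
    using int[OF c(1)] int[OF c(2)] by (simp add: set_lebesgue_integral_def)
  also have "\<dots> = of_real (?m / 2 / sqrt ?m) * (average b (left_child I) - average b (right_child I))"
    by (simp add: integral_eq_average c(1,2,5,6) algebra_simps diff_divide_distrib)
  finally have "cmod (haar_coeff b I) =
      ?m / 2 / sqrt ?m * cmod (average b (left_child I) - average b (right_child I))"
    using c(7) by (simp add: norm_mult norm_divide)
  then show ?thesis
    using c(7) by (simp add: power_mult_distrib power_divide power2_eq_square[of ?m])
qed

text \<open>The comparison point \<open>z\<close> is free. Taken as the average over a larger
  interval, it gives a Chebyshev estimate for intervals whose average has drifted far from
  \<open>z\<close>.\<close>

lemma average_diff_le:
  assumes "locally_integrable b" "I \<in> dyadic_grid"
  shows "measure lebesgue I * cmod (average b I - z) \<le> (LINT x:I|lebesgue. cmod (b x - z))"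
proof -
  note c = dyadic_children[OF assms(2)]
  have "set_integrable lebesgue I (\<lambda>x. z)"
    unfolding set_integrable_def using c(9,10) by simp
  then have "(LINT x:I|lebesgue. b x - z) = of_real (measure lebesgue I) * (average b I - z)"
    using c(9,10) set_integrable_dyadic[OF assms]
    by (simp add: integral_eq_average[OF assms(2), of b] set_integral_const scaleR_conv_of_real algebra_simps)
  then have "measure lebesgue I * cmod (average b I - z) = cmod (LINT x:I|lebesgue. b x - z)"
    using c(7) by (simp add: norm_mult)
  also have "\<dots> \<le> (LINT x:I|lebesgue. cmod (b x - z))"
    using set_integrable_cmod_diff(1)[OF assms] by (rule set_integral_norm_bound)
  finally show ?thesis .
qed

section \<open>Dyadic BMO and the Carleson bound for Haar coefficients\<close>

lemma bmo_oscillation_le: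
  assumes "locally_integrable b" "in_bmo b" "I \<in> dyadic_grid"
  shows "(LINT x:I|lebesgue. cmod (b x - average b I)) \<le> enn2real (bmo_norm b) * measure lebesgue I"
proof -
  note c = dyadic_children[OF assms(3)]
  let ?w = "LINT x:I|lebesgue. cmod (b x - average b I)"
  \<comment> \<open>Finiteness matters here: at infinity \<open>enn2real\<close> returns 0.\<close>
  have fin: "bmo_norm b = ennreal (enn2real (bmo_norm b))"
    using assms(2) by (simp add: in_bmo_def)
  have w0: "?w \<ge> 0" unfolding set_lebesgue_integral_def by simp
  have "(\<integral>\<^sup>+x\<in>I. ennreal (cmod (b x - average b I)) \<partial>lebesgue) =
      (\<integral>\<^sup>+x. ennreal (indicator I x *\<^sub>R cmod (b x - average b I)) \<partial>lebesgue)"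
    by (intro nn_integral_cong) (auto simp: indicator_def)
  also have "\<dots> = ennreal ?w"
    using set_integrable_cmod_diff(2)[OF assms(1,3)]
    unfolding set_lebesgue_integral_def set_integrable_def by (intro nn_integral_eq_integral) auto
  finally have "ennreal (1 / measure lebesgue I) * ennreal ?w \<le> bmo_norm b"
    unfolding bmo_norm_def by (intro SUP_upper2[OF assms(3)]) simp
  then have "ennreal (1 / measure lebesgue I * ?w) \<le> ennreal (enn2real (bmo_norm b))"
    using w0 c(7) fin by (subst ennreal_mult) simp_all
  then have "1 / measure lebesgue I * ?w \<le> enn2real (bmo_norm b)"
    by (simp add: ennreal_le_iff)
  then show ?thesis using c(7) by (simp add: field_simps)
qed

text \<open>The two child averages deviate from that of \<open>I\<close> by opposite amounts, so
  both halves contribute equally to the oscillation. This gives the constant 1; one half alone would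
  give 2.\<close>

lemma average_child_diff_le:
  assumes "locally_integrable b" "in_bmo b" "I \<in> dyadic_grid"
  shows "cmod (average b (left_child I) - average b I) \<le> enn2real (bmo_norm b)"
    "cmod (average b (right_child I) - average b I) \<le> enn2real (bmo_norm b)"
proof -
  note c = dyadic_children[OF assms(3)]
  let ?l = "average b (left_child I) - average b I" and ?r = "average b (right_child I) - average b I"
  have eq: "?r = - ?l"
    using average_children[OF assms(1,3)] by (simp add: field_simps)
  have "measure lebesgue I / 2 * cmod ?l + measure lebesgue I / 2 * cmod ?r
      \<le> (LINT x:I|lebesgue. cmod (b x - average b I))"
    using average_diff_le[OF assms(1) c(1), of "average b I"]
      average_diff_le[OF assms(1) c(2), of "average b I"]
      set_integral_dyadic_split[OF assms(3) set_integrable_cmod_diff(2)[OF assms(1,3)]] c(5,6)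
    by simp
  also have "\<dots> \<le> enn2real (bmo_norm b) * measure lebesgue I"
    by (rule bmo_oscillation_le[OF assms])
  finally have "measure lebesgue I * cmod ?l \<le> measure lebesgue I * enn2real (bmo_norm b)"
    unfolding eq by (simp add: norm_minus_commute field_simps)
  then show "cmod ?l \<le> enn2real (bmo_norm b)" using c(7) by simp
  then show "cmod ?r \<le> enn2real (bmo_norm b)" unfolding eq by (simp add: norm_minus_commute)
qed

text \<open>This is \<open>parallelogram_shift\<close> at the child averages, multiplied by |I|/2,
  the length of each child.\<close>

lemma haar_energy_children:
  assumes "locally_integrable b" "I \<in> dyadic_grid"
  shows "(cmod (haar_coeff b I))\<^sup>2 + measure lebesgue I * (cmod (average b I - z))\<^sup>2 =
    measure lebesgue (left_child I) * (cmod (average b (left_child I) - z))\<^sup>2 +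
    measure lebesgue (right_child I) * (cmod (average b (right_child I) - z))\<^sup>2"
  unfolding cmod_haar_coeff_square[OF assms] dyadic_children(5,6)[OF assms(2)]
    average_children[OF assms]
  using arg_cong[OF parallelogram_shift[of "average b (left_child I)" z "average b (right_child I)"],
      of "\<lambda>t. measure lebesgue I / 2 * t"]
  by (simp add: algebra_simps)

text \<open>Stopping argument at level 2c around a fixed \<open>z\<close>. Averages move by at most
  c per generation, so the bound 3c survives descent from any interval still below 2c; its square
  gives the term 9 c^2 |I|. The integral term pays for everything below the stopping intervals,
  where the Carleson bound is assumed for depths up to n.\<close>

lemma haar_energy_localized:
  assumes "locally_integrable b" "in_bmo b"
  defines "c \<equiv> enn2real (bmo_norm b)"
  assumes IH: "\<And>k J. k \<le> n \<Longrightarrow> J \<in> dyadic_grid \<Longrightarrow>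
      (\<Sum>K\<in>descendants k J. (cmod (haar_coeff b K))\<^sup>2) \<le> 18 * c\<^sup>2 * measure lebesgue J"
    and "I \<in> dyadic_grid" "cmod (average b I - z) \<le> 3 * c"
  shows "(\<Sum>J\<in>descendants n I. (cmod (haar_coeff b J))\<^sup>2) + measure lebesgue I * (cmod (average b I - z))\<^sup>2
    \<le> 9 * c\<^sup>2 * measure lebesgue I + 9 * c * (LINT x:I|lebesgue. cmod (b x - z))"
  using IH \<open>I \<in> dyadic_grid\<close> \<open>cmod (average b I - z) \<le> 3 * c\<close>
proof (induction n arbitrary: I)
  case (0 I)
  have c0: "c \<ge> 0" by (simp add: c_def)
  have "(cmod (average b I - z))\<^sup>2 \<le> (3*c)\<^sup>2" using 0 by (intro power_mono) auto
  then have "measure lebesgue I * (cmod (average b I - z))\<^sup>2 \<le> measure lebesgue I * (9 * c\<^sup>2)"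
    by (intro mult_left_mono) (auto simp: power_mult_distrib)
  moreover have "(LINT x:I|lebesgue. cmod (b x - z)) \<ge> 0"
    unfolding set_lebesgue_integral_def by simp
  ultimately show ?case using c0 by (simp add: algebra_simps add_increasing2)
next
  case (Suc n I)
  have c0: "c \<ge> 0" by (simp add: c_def)
  note ch = dyadic_children[OF Suc.prems(2)]
  show ?case
  proof (cases "cmod (average b I - z) \<ge> 2 * c")
    \<comment> \<open>Stop: the assumed bound covers the whole subtree, and 18 c^2 |I| = 9c (2c |I|)
      is at most 9c times the integral of |b - z|.\<close>
    case True
    have "(cmod (average b I - z))\<^sup>2 \<le> (3*c)\<^sup>2" using Suc.prems by (intro power_mono) auto
    then have "measure lebesgue I * (cmod (average b I - z))\<^sup>2 \<le> measure lebesgue I * (9 * c\<^sup>2)"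
      by (intro mult_left_mono) (auto simp: power_mult_distrib)
    moreover have "measure lebesgue I * (2 * c) \<le> (LINT x:I|lebesgue. cmod (b x - z))"
      using average_diff_le[OF assms(1) Suc.prems(2), of z]
        mult_left_mono[OF True, of "measure lebesgue I"] ch(7) by linarith
    then have "9 * c * (measure lebesgue I * (2 * c)) \<le> 9 * c * (LINT x:I|lebesgue. cmod (b x - z))"
      using c0 by (intro mult_left_mono) auto
    ultimately show ?thesis
      using Suc.prems(1)[of "Suc n" I] Suc.prems(2) by (simp add: power2_eq_square algebra_simps)
  next
    \<comment> \<open>Descend: the energy identity trades the root term for those of the two
      children.\<close>
    case False
    let ?w = "\<lambda>I. LINT x:I|lebesgue. cmod (b x - z)"
    let ?S = "\<lambda>n I. \<Sum>J\<in>descendants n I. (cmod (haar_coeff b J))\<^sup>2"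
    have near: "cmod (average b (left_child I) - z) \<le> 3 * c"
      "cmod (average b (right_child I) - z) \<le> 3 * c"
      using average_child_diff_le[OF assms(1,2) Suc.prems(2)] False
        norm_triangle_ineq[of "average b (left_child I) - average b I" "average b I - z"]
        norm_triangle_ineq[of "average b (right_child I) - average b I" "average b I - z"]
      by (simp_all add: c_def)
    have "?S (Suc n) I + measure lebesgue I * (cmod (average b I - z))\<^sup>2 =
        (?S n (left_child I) + measure lebesgue (left_child I) * (cmod (average b (left_child I) - z))\<^sup>2) +
        (?S n (right_child I) + measure lebesgue (right_child I) * (cmod (average b (right_child I) - z))\<^sup>2)"
      using haar_energy_children[OF assms(1) Suc.prems(2), of z]
      unfolding sum_descendants_Suc[OF Suc.prems(2)] by simp
    also have "\<dots> \<le> (9 * c\<^sup>2 * measure lebesgue (left_child I) + 9 * c * ?w (left_child I)) +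
        (9 * c\<^sup>2 * measure lebesgue (right_child I) + 9 * c * ?w (right_child I))"
      using Suc.prems(1) by (intro add_mono Suc.IH near ch(1,2)) auto
    also have "\<dots> = 9 * c\<^sup>2 * measure lebesgue I + 9 * c * ?w I"
      unfolding ch(5,6) set_integral_dyadic_split[OF Suc.prems(2)
          set_integrable_cmod_diff(2)[OF assms(1) Suc.prems(2)]]
      by (simp add: algebra_simps)
    finally show ?thesis .
  qed
qed

text \<open>Strong induction on the depth. The localized estimate is applied at the children, since
  at \<open>I\<close> itself it would require the claim at the same depth n. With \<open>z\<close>
  the average over \<open>I\<close>, the root term vanishes and both children start within c of
  \<open>z\<close>.\<close>

lemma haar_carleson:
  assumes "locally_integrable b" "in_bmo b" "I \<in> dyadic_grid"
  shows "(\<Sum>J\<in>descendants n I. (cmod (haar_coeff b J))\<^sup>2)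
    \<le> 18 * (enn2real (bmo_norm b))\<^sup>2 * measure lebesgue I"
  using assms(3)
proof (induction n arbitrary: I rule: less_induct)
  case (less n)
  define c where "c = enn2real (bmo_norm b)"
  have c0: "c \<ge> 0" by (simp add: c_def)
  note ch = dyadic_children[OF less.prems]
  show ?case
  proof (cases n)
    case (Suc k)
    let ?z = "average b I"
    let ?S = "\<lambda>n I. \<Sum>J\<in>descendants n I. (cmod (haar_coeff b J))\<^sup>2"
    let ?w = "\<lambda>I. LINT x:I|lebesgue. cmod (b x - ?z)"
    have loc: "?S k J + measure lebesgue J * (cmod (average b J - ?z))\<^sup>2
        \<le> 9 * c\<^sup>2 * measure lebesgue J + 9 * c * ?w J"
      if "J \<in> dyadic_grid" "cmod (average b J - ?z) \<le> c" for J
      using haar_energy_localized[OF assms(1,2) less.IH, of k J ?z] order_trans[OF that(2), of "3 * c"] that Suc c0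
      by (simp add: c_def)
    have "?S n I = (?S k (left_child I) + measure lebesgue (left_child I) * (cmod (average b (left_child I) - ?z))\<^sup>2) +
        (?S k (right_child I) + measure lebesgue (right_child I) * (cmod (average b (right_child I) - ?z))\<^sup>2)"
      using haar_energy_children[OF assms(1) less.prems, of ?z]
      unfolding Suc sum_descendants_Suc[OF less.prems] by simp
    also have "\<dots> \<le> (9 * c\<^sup>2 * measure lebesgue (left_child I) + 9 * c * ?w (left_child I)) +
        (9 * c\<^sup>2 * measure lebesgue (right_child I) + 9 * c * ?w (right_child I))"
      using average_child_diff_le[OF assms(1,2) less.prems]
      by (intro add_mono loc ch(1,2)) (auto simp: c_def)
    also have "\<dots> = 9 * c\<^sup>2 * measure lebesgue I + 9 * c * ?w I"
      unfolding ch(5,6) set_integral_dyadic_split[OF less.prems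
          set_integrable_cmod_diff(2)[OF assms(1) less.prems]]
      by (simp add: algebra_simps)
    \<comment> \<open>The oscillation around the average of \<open>I\<close> is at most c |I|, so 9
      + 9 = 18 closes the induction.\<close>
    also have "\<dots> \<le> 9 * c\<^sup>2 * measure lebesgue I + 9 * c * (c * measure lebesgue I)"
      using bmo_oscillation_le[OF assms(1,2) less.prems] c0
      by (intro add_left_mono mult_left_mono) (auto simp: c_def)
    finally show ?thesis by (simp add: c_def power2_eq_square)
  qed simp
qed

text \<open>Cauchy-Schwarz on the truncated tree; squares are compared to avoid roots of the two
  Carleson bounds.\<close>

lemma haar_product_carleson:
  assumes "locally_integrable b" "in_bmo b" "locally_integrable d" "in_bmo d" "I \<in> dyadic_grid"
  shows "(\<Sum>J\<in>descendants n I. cmod (haar_product b d J))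
    \<le> 18 * enn2real (bmo_norm b) * enn2real (bmo_norm d) * measure lebesgue I"
proof (rule power2_le_imp_le)
  let ?m = "measure lebesgue I"
  have "(\<Sum>J\<in>descendants n I. cmod (haar_product b d J))\<^sup>2
      \<le> (\<Sum>J\<in>descendants n I. (cmod (haar_coeff b J))\<^sup>2) * (\<Sum>J\<in>descendants n I. (cmod (haar_coeff d J))\<^sup>2)"
    unfolding haar_product_def norm_mult by (rule Cauchy_Schwarz_ineq_sum)
  also have "\<dots> \<le> (18 * (enn2real (bmo_norm b))\<^sup>2 * ?m) * (18 * (enn2real (bmo_norm d))\<^sup>2 * ?m)"
    using haar_carleson[OF assms(1,2,5)] haar_carleson[OF assms(3,4,5)]
    by (intro mult_mono) (auto intro: sum_nonneg)
  also have "\<dots> = (18 * enn2real (bmo_norm b) * enn2real (bmo_norm d) * ?m)\<^sup>2"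
    by (simp add: power2_eq_square)
  finally show "(\<Sum>J\<in>descendants n I. cmod (haar_product b d J))\<^sup>2
      \<le> (18 * enn2real (bmo_norm b) * enn2real (bmo_norm d) * ?m)\<^sup>2" .
qed simp

section \<open>The operators \<open>S_hat\<close> and \<open>E_op\<close> under an l^1 Carleson
  condition\<close>

lemma haar_val_child:
  assumes "I \<in> dyadic_grid" "J \<noteq> {}"
  shows "J \<subseteq> left_child I \<Longrightarrow> haar_val I J = 1 / sqrt (measure lebesgue I)"
    "J \<subseteq> right_child I \<Longrightarrow> haar_val I J = - 1 / sqrt (measure lebesgue I)"
proof -
  \<comment> \<open>A point of \<open>J\<close> makes the constant unique, as the definite
    description in \<open>haar_val\<close> requires.\<close>
  obtain y where y: "y \<in> J" using assms(2) by blast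
  have eq: "haar_val I J = c" if "\<And>x. x \<in> J \<Longrightarrow> haar I x = c" for c
    unfolding haar_val_def using that y by (intro the_equality) auto
  note disj = dyadic_children(4)[OF assms(1)]
  show "J \<subseteq> left_child I \<Longrightarrow> haar_val I J = 1 / sqrt (measure lebesgue I)"
    using disj by (intro eq) (auto simp: haar_def indicator_def)
  show "J \<subseteq> right_child I \<Longrightarrow> haar_val I J = - 1 / sqrt (measure lebesgue I)"
    using disj by (intro eq) (auto simp: haar_def indicator_def)
qed

text \<open>The remaining estimates concern any sequence with this l^1 Carleson bound; Haar products
  enter again only in the theorem.\<close>

context
  fixes a :: "real set \<Rightarrow> complex" and K :: real
  assumes carleson: "\<And>I n. I \<in> dyadic_grid \<Longrightarrow>
    (\<Sum>J\<in>descendants n I. cmod (a J)) \<le> K * measure lebesgue I"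
begin

lemma infsum_dyadic_below_children:
  assumes "I \<in> dyadic_grid"
  shows "infsum a (dyadic_below I) =
    a I + (infsum a (dyadic_below (left_child I)) + infsum a (dyadic_below (right_child I)))"
proof -
  note ch = dyadic_children[OF assms] and s = dyadic_below_strict[OF assms]
  note sm = summable_on_dyadic_below(1)[OF ch(1) carleson[OF ch(1)]]
    summable_on_dyadic_below(1)[OF ch(2) carleson[OF ch(2)]]
  show ?thesis
    unfolding s(3) infsum_insert[OF summable_on_Un_disjoint[OF sm s(2)] s(4)]
      infsum_Un_disjoint[OF sm s(2)] ..
qed

text \<open>The weight \<open>haar_val I J\<close> depends on \<open>J\<close> only through the
  child containing it, so it is one constant on each subtree and factors out.\<close>

lemma has_sum_S_hat:
  assumes "I \<in> dyadic_grid"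
  shows "((\<lambda>J. a J * of_real (haar_val I J)) has_sum
    (infsum a (dyadic_below (left_child I)) - infsum a (dyadic_below (right_child I)))
      / of_real (sqrt (measure lebesgue I))) {J \<in> dyadic_grid. J \<subset> I}"
proof -
  note ch = dyadic_children[OF assms] and s = dyadic_below_strict[OF assms]
  let ?r = "complex_of_real (1 / sqrt (measure lebesgue I))"
  have l: "((\<lambda>J. a J * of_real (haar_val I J)) has_sum infsum a (dyadic_below (left_child I)) * ?r)
      (dyadic_below (left_child I))"
    using has_sum_cmult_left[OF has_sum_infsum[OF summable_on_dyadic_below(1)[OF ch(1) carleson[OF ch(1)]]], of ?r]
    by (rule has_sum_cong[THEN iffD1, rotated])
       (auto simp: haar_val_child(1)[OF assms dyadic_children(8)])
  have r: "((\<lambda>J. a J * of_real (haar_val I J)) has_sum infsum a (dyadic_below (right_child I)) * (- ?r))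
      (dyadic_below (right_child I))"
    using has_sum_cmult_left[OF has_sum_infsum[OF summable_on_dyadic_below(1)[OF ch(2) carleson[OF ch(2)]]], of "- ?r"]
    by (rule has_sum_cong[THEN iffD1, rotated])
       (auto simp: haar_val_child(2)[OF assms dyadic_children(8)])
  show ?thesis
    using has_sum_Un_disjoint[OF l r s(2)] unfolding s(1)
    by (simp add: diff_divide_distrib)
qed

lemma S_hat_eq:
  assumes "I \<in> dyadic_grid"
  shows "S_hat a I = (infsum a (dyadic_below (left_child I)) - infsum a (dyadic_below (right_child I)))
      / of_real (sqrt (measure lebesgue I))"
  unfolding S_hat_def using has_sum_S_hat[OF assms] by (rule infsumI)

text \<open>With u, v the sums over the two subtrees, the parallelogram law links |u - v|^2, which
  is |I| |S_I|^2, to |u + v|^2. Since u + v = P_I - a_I, replacing it by P_I costs at most 2 |P_I|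
  |a_I| <= 2 K |I| |a_I|.\<close>

lemma S_hat_energy_step:
  assumes "I \<in> dyadic_grid"
  defines "P \<equiv> \<lambda>I. infsum a (dyadic_below I)"
  shows "(cmod (S_hat a I))\<^sup>2 + (cmod (P I))\<^sup>2 / measure lebesgue I
    \<le> (cmod (P (left_child I)))\<^sup>2 / measure lebesgue (left_child I) +
      (cmod (P (right_child I)))\<^sup>2 / measure lebesgue (right_child I) + 2 * K * cmod (a I)"
proof -
  note ch = dyadic_children[OF assms(1)]
  let ?m = "measure lebesgue I" and ?u = "P (left_child I)" and ?v = "P (right_child I)"
  have P: "P I = a I + (?u + ?v)"
    unfolding P_def by (rule infsum_dyadic_below_children[OF assms(1)])
  have PK: "cmod (P I) \<le> K * ?m"
    unfolding P_def by (rule summable_on_dyadic_below(2)[OF assms(1) carleson[OF assms(1)]])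
  have "\<bar>cmod (P I) - cmod (a I)\<bar> \<le> cmod (?u + ?v)"
    using norm_triangle_ineq3[of "P I" "a I"] by (simp add: P)
  then have "(cmod (P I) - cmod (a I))\<^sup>2 \<le> (cmod (?u + ?v))\<^sup>2"
    by (rule abs_le_square_iff[THEN iffD1, OF order_trans]) simp
  moreover have "cmod (P I) * cmod (a I) \<le> K * ?m * cmod (a I)"
    using PK by (intro mult_right_mono) auto
  \<comment> \<open>Expand the square and drop the nonnegative |a_I|^2.\<close>
  ultimately have "(cmod (P I))\<^sup>2 \<le> (cmod (?u + ?v))\<^sup>2 + 2 * (K * ?m * cmod (a I))"
    using zero_le_power2[of "cmod (a I)"] unfolding power2_diff mult.assoc by linarith
  moreover have "(cmod (?u - ?v))\<^sup>2 + (cmod (?u + ?v))\<^sup>2 = 2 * (cmod ?u)\<^sup>2 + 2 * (cmod ?v)\<^sup>2"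
    unfolding cmod_power2 by (simp add: power2_eq_square algebra_simps)
  ultimately have "(cmod (?u - ?v))\<^sup>2 + (cmod (P I))\<^sup>2
      \<le> 2 * (cmod ?u)\<^sup>2 + 2 * (cmod ?v)\<^sup>2 + 2 * (K * ?m * cmod (a I))"
    by linarith
  \<comment> \<open>The factors 2 are absorbed by the child lengths |I|/2.\<close>
  from divide_right_mono[OF this, of ?m]
  have "(cmod (?u - ?v))\<^sup>2 / ?m + (cmod (P I))\<^sup>2 / ?m
      \<le> (cmod ?u)\<^sup>2 / (?m / 2) + (cmod ?v)\<^sup>2 / (?m / 2) + 2 * K * cmod (a I)"
    using ch(7) by (simp add: field_simps)
  moreover have "(cmod (S_hat a I))\<^sup>2 = (cmod (?u - ?v))\<^sup>2 / ?m"
    unfolding S_hat_eq[OF assms(1)] P_def using ch(7) by (simp add: norm_divide power_divide)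
  ultimately show ?thesis unfolding ch(5,6) by simp
qed

text \<open>Telescoping \<open>S_hat_energy_step\<close>. At depth 0 the potential is at most K^2
  |I|, and these bounds add up exactly over the children.\<close>

lemma S_hat_energy_potential:
  assumes "I \<in> dyadic_grid"
  shows "(\<Sum>J\<in>descendants n I. (cmod (S_hat a J))\<^sup>2) + (cmod (infsum a (dyadic_below I)))\<^sup>2 / measure lebesgue I
    \<le> K\<^sup>2 * measure lebesgue I + 2 * K * (\<Sum>J\<in>descendants n I. cmod (a J))"
  using assms
proof (induction n arbitrary: I)
  case 0
  have "(cmod (infsum a (dyadic_below I)))\<^sup>2 \<le> (K * measure lebesgue I)\<^sup>2"
    by (intro power_mono summable_on_dyadic_below(2)[OF 0 carleson[OF 0]]) simp
  then show ?case
    using dyadic_children(7)[OF 0] by (simp add: field_simps power2_eq_square)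
next
  case (Suc n)
  note ch = dyadic_children[OF Suc.prems]
  show ?case
    using S_hat_energy_step[OF Suc.prems] Suc.IH[OF ch(1)] Suc.IH[OF ch(2)]
    unfolding sum_descendants_Suc[OF Suc.prems] ch(5,6) by (simp add: algebra_simps)
qed

text \<open>The argument gives 3 K^2; it is rounded up to 4 K^2, whose root is 2K.\<close>

lemma S_hat_energy:
  assumes "I \<in> dyadic_grid" "K \<ge> 0"
  shows "(\<Sum>J\<in>descendants n I. (cmod (S_hat a J))\<^sup>2) \<le> 4 * K\<^sup>2 * measure lebesgue I"
proof -
  have "2 * K * (\<Sum>J\<in>descendants n I. cmod (a J)) \<le> 2 * K * (K * measure lebesgue I)"
    using carleson[OF assms(1)] assms(2) by (intro mult_left_mono) auto
  moreover have "(cmod (infsum a (dyadic_below I)))\<^sup>2 / measure lebesgue I \<ge> 0"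
    "K\<^sup>2 * measure lebesgue I \<ge> 0" by simp_all
  ultimately show ?thesis
    using S_hat_energy_potential[OF assms(1), of n] unfolding power2_eq_square mult.assoc by linarith
qed

lemma summability_of_carleson:
  shows "S_hat_summable a" "E_op_summable a"
  unfolding S_hat_summable_def E_op_summable_def
  using has_sum_S_hat has_sum_imp_summable summable_on_dyadic_below(1) carleson by blast+

lemma cm_norm_S_hat_le:
  assumes "K \<ge> 0"
  shows "cm_norm (S_hat a) \<le> ennreal (2 * K)"
proof -
  let ?X = "SUP I\<in>dyadic_grid. ennreal (1 / measure lebesgue I) *
     (\<Sum>\<^sub>\<infinity>J\<in>dyadic_below I. ennreal ((cmod (S_hat a J))\<^sup>2))"
  have "?X \<le> ennreal (4 * K\<^sup>2)"
  proof (rule SUP_least)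
    fix I assume I: "I \<in> dyadic_grid"
    let ?m = "measure lebesgue I"
    have "(\<Sum>\<^sub>\<infinity>J\<in>dyadic_below I. ennreal ((cmod (S_hat a J))\<^sup>2)) \<le> ennreal (4 * K\<^sup>2 * ?m)"
      using finite_sum_dyadic_below_le[OF I _ S_hat_energy[OF I assms]]
      by (subst nonneg_infsum_complete) (auto intro!: SUP_least ennreal_leI)
    then have "ennreal (1 / ?m) * (\<Sum>\<^sub>\<infinity>J\<in>dyadic_below I. ennreal ((cmod (S_hat a J))\<^sup>2))
        \<le> ennreal (1 / ?m) * ennreal (4 * K\<^sup>2 * ?m)"
      by (intro mult_left_mono) auto
    also have "\<dots> = ennreal (4 * K\<^sup>2)"
      using dyadic_children(7)[OF I] by (subst ennreal_mult[symmetric]) auto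
    finally show "ennreal (1 / ?m) * (\<Sum>\<^sub>\<infinity>J\<in>dyadic_below I. ennreal ((cmod (S_hat a J))\<^sup>2))
        \<le> ennreal (4 * K\<^sup>2)" .
  qed
  \<comment> \<open>The supremum is now known to be real, so \<open>ennreal_sqrt\<close> takes its
    finite branch.\<close>
  then obtain r where r: "?X = ennreal r" "0 \<le> r" "r \<le> 4 * K\<^sup>2"
    by (auto simp: le_ennreal_iff)
  have "sqrt r \<le> 2 * K"
    using r assms by (intro real_le_lsqrt) (auto simp: power_mult_distrib)
  then show ?thesis
    unfolding cm_norm_def r(1) ennreal_sqrt_def using r(2) by (simp add: ennreal_leI)
qed

lemma linf_norm_E_op_le: "linf_norm (E_op a) \<le> ennreal K"
  unfolding linf_norm_def
proof (intro SUP_least ennreal_leI)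
  fix I assume I: "I \<in> dyadic_grid"
  show "cmod (E_op a I) \<le> K"
    using summable_on_dyadic_below(2)[OF I carleson[OF I]] dyadic_children(7)[OF I]
    by (simp add: E_op_def norm_divide field_simps)
qed

end

theorem proposition1p4:
  shows "\<exists>C::real. C > 0 \<and>
    (\<forall>b d :: real \<Rightarrow> complex.
       locally_integrable b \<longrightarrow> locally_integrable d \<longrightarrow> in_bmo b \<longrightarrow> in_bmo d \<longrightarrow>
         S_hat_summable (haar_product b d) \<and> E_op_summable (haar_product b d) \<and>
         cm_norm (S_hat (haar_product b d)) + linf_norm (E_op (haar_product b d))
           \<le> ennreal C * bmo_norm b * bmo_norm d)"
proof (intro exI[of _ 54] conjI allI impI)
  fix b d :: "real \<Rightarrow> complex"
  assume h: "locally_integrable b" "locally_integrable d" "in_bmo b" "in_bmo d"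
  define K where "K = 18 * enn2real (bmo_norm b) * enn2real (bmo_norm d)"
  have carleson: "(\<Sum>J\<in>descendants n I. cmod (haar_product b d J)) \<le> K * measure lebesgue I"
    if "I \<in> dyadic_grid" for I n
    unfolding K_def using h(1,3,2,4) that by (rule haar_product_carleson)
  show "S_hat_summable (haar_product b d)" "E_op_summable (haar_product b d)"
    using summability_of_carleson[OF carleson] by simp_all
  have K0: "K \<ge> 0" by (simp add: K_def)
  have "cm_norm (S_hat (haar_product b d)) + linf_norm (E_op (haar_product b d))
      \<le> ennreal (2 * K) + ennreal K"
    using carleson K0 by (intro add_mono cm_norm_S_hat_le linf_norm_E_op_le)
  \<comment> \<open>The witness 54 is 3 times the 18 in K: 2K from the Carleson norm and K from the
    supremum norm.\<close>
  also have "\<dots> = ennreal (54 * enn2real (bmo_norm b) * enn2real (bmo_norm d))"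
    using K0 by (simp add: ennreal_plus[symmetric] K_def del: ennreal_plus)
  also have "\<dots> = ennreal 54 * bmo_norm b * bmo_norm d"
    using h(3,4) by (simp add: ennreal_mult in_bmo_def)
  finally show "cm_norm (S_hat (haar_product b d)) + linf_norm (E_op (haar_product b d))
      \<le> ennreal 54 * bmo_norm b * bmo_norm d" .
qed simp

end
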